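(* Let $\mathbb{D}$ be the open unit disc, let $f=h\overline g:\mathbb{D}\to\mathbb{C}$ be a non-vanishing logharmonic sense-preserving mapping with dilatation $\omega$, and let $c\in\mathbb{C}$ be such that $|c|\leq 1$ and $c\neq -1$. If for all $z\in\mathbb{D}$ $$\left|(1-|z|^2)zP_f(z)+c|z|^2\right|+(1+|\omega(z)|)\left|(1-|z|^2)z\frac{h'}{h}(z)\right|+\frac{|z\omega'(z)|(1-|z|^2)}{1-|\omega(z)|^2}\leq1,$$ then $f$ is univalent (injective) in $\mathbb{D}$. The constant $1$ is sharp: for every $C>1$ the statement (for all such $f$ and $c$) fails if the right-hand side $1$ is replaced by $C$.
   Context: A non-vanishing sense-preserving (locally univalent) logharmonic mapping $f=h\overline{g}$ on a domain: $h,g$ are non-vanishing analytic functions there, $h'$ does not vanish, and the (second complex) dilatation $\omega=\dfrac{g'h}{gh'}$ satisfies $|\omega|<1$ everywhere. Its pre-Schwarzian derivative is $$P_f=\frac{h''}{h'}+\omega\frac{h'}{h}-\frac{\omega'\overline{\omega}}{1-|\omega|^2}.$$ *)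

theory Defs
  imports "HOL-Complex_Analysis.Complex_Analysis"
begin

definition lh_dilatation :: "(complex \<Rightarrow> complex) \<Rightarrow> (complex \<Rightarrow> complex) \<Rightarrow> complex \<Rightarrow> complex" where
  "lh_dilatation h g z = (deriv g z * h z) / (g z * deriv h z)"

text \<open>A mapping is given together with its analytic factors.  The factors \<open>h\<close>, \<open>g\<close> are
  determined by \<open>f\<close> only up to replacing them by \<open>a h\<close> and \<open>g / cnj a\<close> with a constant
  \<open>a \<noteq> 0\<close>; the dilatation, the quotient \<open>h' / h\<close> and the pre-Schwarzian
  derivative are unaffected by this choice, so all of them are taken as functions of
  \<open>h\<close> and \<open>g\<close>.\<close>

definition sense_preserving_logharmonic_on ::
    "complex set \<Rightarrow> (complex \<Rightarrow> complex) \<Rightarrow> (complex \<Rightarrow> complex) \<Rightarrow> (complex \<Rightarrow> complex) \<Rightarrow> bool" where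
  "sense_preserving_logharmonic_on S f h g \<longleftrightarrow>
     open S \<and> connected S \<and> S \<noteq> {} \<and>
     h holomorphic_on S \<and> g holomorphic_on S \<and>
     (\<forall>z\<in>S. f z = h z * cnj (g z) \<and> h z \<noteq> 0 \<and> g z \<noteq> 0 \<and> deriv h z \<noteq> 0 \<and>
            cmod (lh_dilatation h g z) < 1)"

definition pre_schwarzian :: "(complex \<Rightarrow> complex) \<Rightarrow> (complex \<Rightarrow> complex) \<Rightarrow> complex \<Rightarrow> complex" where
  "pre_schwarzian h g z =
     deriv (deriv h) z / deriv h z
     + lh_dilatation h g z * (deriv h z / h z)
     - deriv (lh_dilatation h g) z * cnj (lh_dilatation h g z)
         / of_real (1 - (cmod (lh_dilatation h g z))\<^sup>2)"

definition criterion_lhs ::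
    "(complex \<Rightarrow> complex) \<Rightarrow> (complex \<Rightarrow> complex) \<Rightarrow> complex \<Rightarrow> complex \<Rightarrow> real" where
  "criterion_lhs h g c z =
     cmod (of_real (1 - (cmod z)\<^sup>2) * z * pre_schwarzian h g z + c * of_real ((cmod z)\<^sup>2))
     + (1 + cmod (lh_dilatation h g z))
         * cmod (of_real (1 - (cmod z)\<^sup>2) * z * (deriv h z / h z))
     + cmod (z * deriv (lh_dilatation h g) z) * (1 - (cmod z)\<^sup>2)
         / (1 - (cmod (lh_dilatation h g z))\<^sup>2)"

end

theory Submission
  imports Defs
begin

text \<open>Write \<open>g = exp L\<close>. If \<open>f x = f y\<close>, then \<open>h x / h y = exp (cnj (L y - L x))\<close>, and
  \<open>cnj w = \<lambda> w\<close> for some unimodular \<open>\<lambda>\<close>, so the analytic function \<open>\<phi> = h exp (\<lambda> L)\<close> takes the same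
  value at \<open>x\<close> and \<open>y\<close>. Now \<open>\<phi>''/\<phi>'\<close> differs from the pre-Schwarzian derivative by
  \<open>(\<lambda> - 1) \<omega> h'/h\<close> and a multiple of \<open>\<omega>'\<close> of modulus \<open>1 / (1 - \<bar>\<omega>\<bar>\<^sup>2)\<close>, so the hypothesis implies
  Ahlfors' univalence criterion for \<open>\<phi>\<close>.

  Ahlfors' criterion is proved with a Loewner chain: two distinct points with the same image can be
  moved inwards as the parameter grows, which is impossible because the members of the chain with a
  large parameter are injective.\<close>

section \<open>Analytic tools: divided differences and first-order solutions of equations with a
  parameter\<close>

text \<open>The derivative on the diagonal makes this jointly continuous, so a limit of collisions
  of distinct points remains visible as a zero even when the two points merge.\<close>

definition divided_difference :: "(complex \<Rightarrow> complex) \<Rightarrow> complex \<Rightarrow> complex \<Rightarrow> complex" where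
  "divided_difference f a b = (if a = b then deriv f a else (f a - f b) / (a - b))"

lemma continuous_on_divided_difference:
  assumes hol: "f holomorphic_on S" and "open S"
  shows "continuous_on (S \<times> S) (\<lambda>p. divided_difference f (fst p) (snd p))"
proof -
  have "isCont (\<lambda>p. divided_difference f (fst p) (snd p)) (a, b)"
    if ab: "a \<in> S" "b \<in> S" for a b
  proof (cases "a = b")
    case False
    have "isCont f a" "isCont f b"
      using assms ab holomorphic_on_imp_continuous_on[OF hol] by (auto simp: continuous_on_eq_continuous_at)
    then have "isCont (\<lambda>p. (f (fst p) - f (snd p)) / (fst p - snd p)) (a, b)"
      using False by (intro continuous_divide continuous_diff continuous_fst continuous_snd isCont_o2[where f = fst] isCont_o2[where f = snd] continuous_ident) auto
    moreover have "open {p :: complex \<times> complex. fst p \<noteq> snd p}"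
      by (intro open_Collect_neq continuous_intros)
    then have "\<forall>\<^sub>F p in nhds (a, b). p \<in> {p. fst p \<noteq> snd p}"
      using False by (intro eventually_nhds_in_open) auto
    then have "\<forall>\<^sub>F p in nhds (a, b). (f (fst p) - f (snd p)) / (fst p - snd p)
        = divided_difference f (fst p) (snd p)"
      by eventually_elim (auto simp: divided_difference_def)
    ultimately show ?thesis
      by (simp add: isCont_cong)
  next
    case True
    have "isCont (deriv f) a"
      using assms ab holomorphic_on_imp_continuous_on[OF holomorphic_deriv[OF hol]]
      by (auto simp: continuous_on_eq_continuous_at)
    show ?thesis
      unfolding continuous_at_eps_delta
    proof (intro allI impI)
      fix e :: real assume "0 < e"
      then obtain d1 where d1: "d1 > 0" "\<And>x. dist x a < d1 \<Longrightarrow> dist (deriv f x) (deriv f a) < e / 2"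
        using \<open>isCont (deriv f) a\<close> unfolding continuous_at_eps_delta by (metis half_gt_zero)
      obtain d2 where d2: "d2 > 0" "ball a d2 \<subseteq> S"
        using \<open>open S\<close> ab by (meson open_contains_ball)
      define d where "d = min d1 d2"
      have "ball a d \<subseteq> S" using d2(2) by (auto simp: d_def)
      then have der: "(f has_field_derivative deriv f x) (at x)" if "x \<in> ball a d" for x
        using that by (intro holomorphic_derivI[OF hol \<open>open S\<close>]) auto
      have "dist (divided_difference f x y) (deriv f a) < e"
        if xy: "x \<in> ball a d" "y \<in> ball a d" for x y
      proof (cases "x = y")
        case True
        then show ?thesis
          using d1(2)[of x] xy \<open>0 < e\<close> by (auto simp: divided_difference_def d_def dist_commute)
      next
        case False
        \<comment> \<open>Subtracting the linear map with slope \<open>deriv f a\<close> leaves a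
          function whose derivative is at most \<open>e / 2\<close> on the convex ball, so the mean
          value inequality bounds its difference quotients.\<close>
        have "norm ((f x - deriv f a * x) - (f y - deriv f a * y)) \<le> (e / 2) * norm (x - y)"
        proof (rule field_differentiable_bound[of "ball a d" "\<lambda>z. f z - deriv f a * z" "\<lambda>z. deriv f z - deriv f a"])
          fix z assume z: "z \<in> ball a d"
          show "((\<lambda>z. f z - deriv f a * z) has_field_derivative deriv f z - deriv f a) (at z within ball a d)"
            by (rule has_field_derivative_at_within) (auto intro!: derivative_eq_intros der[OF z])
          show "norm (deriv f z - deriv f a) \<le> e / 2"
            using d1(2)[of z] z by (auto simp: d_def dist_norm norm_minus_commute)
        qed (use xy in auto)
        moreover have "divided_difference f x y - deriv f a
            = ((f x - deriv f a * x) - (f y - deriv f a * y)) / (x - y)"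
          using False by (simp add: divided_difference_def field_simps)
        ultimately have "norm (divided_difference f x y - deriv f a) \<le> e / 2"
          using False by (simp add: norm_divide divide_le_eq)
        then show ?thesis
          using \<open>0 < e\<close> by (simp add: dist_norm)
      qed
      moreover have "fst p \<in> ball a d \<and> snd p \<in> ball a d" if "dist p (a, b) < d" for p
        using that True dist_fst_le[of p "(a, b)"] dist_snd_le[of p "(a, b)"]
        by (auto simp: dist_commute)
      ultimately have "\<forall>p. dist p (a, b) < d \<longrightarrow>
          dist (divided_difference f (fst p) (snd p)) (divided_difference f (fst (a, b)) (snd (a, b))) < e"
        using True by (auto simp: divided_difference_def)
      then show "\<exists>d>0. \<forall>p. dist p (a, b) < d \<longrightarrow>
          dist (divided_difference f (fst p) (snd p)) (divided_difference f (fst (a, b)) (snd (a, b))) < e"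
        using d1 d2 by (intro exI[of _ d]) (auto simp: d_def)
    qed
  qed
  then show ?thesis
    by (force intro: continuous_at_imp_continuous_on)
qed

text \<open>Brouwer's theorem applied to a Newton step: no inverse function theorem is needed, and the
  solution comes with its first-order expansion in \<open>t\<close>.\<close>

lemma implicit_solution_first_order:
  fixes F :: "real \<Rightarrow> complex \<Rightarrow> complex"
  assumes der: "((\<lambda>(t, z). F t z) has_derivative (\<lambda>(t, z). A * of_real t + B * z)) (at (u, a))"
    and B: "B \<noteq> 0" and S: "open S" "a \<in> S" "\<And>t. continuous_on S (F t)" and e: "0 < e"
  shows "\<forall>\<^sub>F t in at_right 0. \<exists>z. F (u + t) z = F u a \<and> norm (z - (a - of_real t * (A / B))) \<le> e * t"
proof -
  define v where "v = A / B"
  \<comment> \<open>For \<open>z\<close> within \<open>e * t\<close> of the predicted solution,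
    \<open>(u + t, z)\<close> is at distance at most \<open>t * M\<close> from
    \<open>(u, a)\<close>: the parameter contributes \<open>t\<close>, the shift
    \<open>t * norm v\<close>, the radius \<open>e * t\<close>.\<close>
  define M where "M = 1 + norm v + e"
  have M: "M > 0" using e by (simp add: M_def add_nonneg_pos)
  \<comment> \<open>With this tolerance the linearisation error \<open>e' * (t * M)\<close>, divided
    by \<open>norm B\<close>, is exactly the radius \<open>e * t\<close>.\<close>
  define e' where "e' = e * norm B / M"
  have e': "e' > 0" using M e B by (simp add: e'_def)
  obtain d1 where d1: "d1 > 0"
    "\<And>p. norm (p - (u, a)) < d1 \<Longrightarrow>
       norm ((\<lambda>(t, z). F t z) p - F u a - (\<lambda>(t, z). A * of_real t + B * z) (p - (u, a))) \<le> e' * norm (p - (u, a))"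
    using der e' unfolding has_derivative_at_alt by (auto simp: case_prod_beta)
  obtain d2 where d2: "d2 > 0" "ball a d2 \<subseteq> S"
    using S by (meson open_contains_ball)
  define d where "d = min d1 d2 / M"
  have d: "d > 0" using d1 d2 M by (simp add: d_def)
  have "\<exists>z. F (u + t) z = F u a \<and> norm (z - (a - of_real t * (A / B))) \<le> e * t"
    if t: "0 < t" "t < d" for t
  proof -
    define b where "b = a - of_real t * v"
    \<comment> \<open>A Newton step with the derivative frozen at \<open>B\<close>; its fixed points
      are the solutions sought.\<close>
    define G where "G z = z - (F (u + t) z - F u a) / B" for z
    have tM: "t * M < d1" "t * M < d2"
      using t M by (auto simp: d_def field_simps)
    have nza: "norm (z - a) \<le> t * (norm v + e)" if "z \<in> cball b (e * t)" for z
    proof -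
      have "norm (z - a) = norm ((z - b) - of_real t * v)" by (simp add: b_def)
      also have "\<dots> \<le> norm (z - b) + norm (of_real t * v)" by (rule norm_triangle_ineq4)
      also have "\<dots> \<le> e * t + t * norm v"
        using that t by (auto simp: dist_norm norm_mult norm_minus_commute)
      finally show ?thesis by (simp add: algebra_simps)
    qed
    have sub: "cball b (e * t) \<subseteq> S"
    proof
      fix z assume "z \<in> cball b (e * t)"
      then have "norm (z - a) \<le> t * (norm v + e)" by (rule nza)
      also have "\<dots> < t * M" using t by (simp add: M_def)
      finally show "z \<in> S" using d2(2) tM by (auto simp: subset_iff dist_norm norm_minus_commute)
    qed
    have "continuous_on (cball b (e * t)) G"
      unfolding G_def using continuous_on_subset[OF S(3) sub] B by (intro continuous_intros) auto
    moreover have "G \<in> cball b (e * t) \<rightarrow> cball b (e * t)"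
    proof
      fix z assume z: "z \<in> cball b (e * t)"
      have "norm ((u + t, z) - (u, a)) \<le> norm t + norm (z - a)"
        by (simp add: norm_Pair sqrt_sum_squares_le_sum_abs[THEN order_trans])
      also have "\<dots> \<le> t + t * (norm v + e)" using nza[OF z] t by simp
      finally have n: "norm ((u + t, z) - (u, a)) \<le> t * M" by (simp add: M_def algebra_simps)
      then have "norm ((\<lambda>(t, z). F t z) (u + t, z) - F u a
            - (\<lambda>(t, z). A * of_real t + B * z) ((u + t, z) - (u, a))) \<le> e' * norm ((u + t, z) - (u, a))"
        using tM by (intro d1(2)) linarith
      also have "\<dots> \<le> e' * (t * M)" using n e' by (intro mult_left_mono) auto
      also have "\<dots> = e * t * norm B" using M by (simp add: e'_def)
      finally have *: "norm (F (u + t) z - F u a - (A * of_real t + B * (z - a))) \<le> e * t * norm B"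
        by simp
      have "b - G z = (F (u + t) z - F u a - (A * of_real t + B * (z - a))) / B"
        using B by (simp add: G_def b_def v_def field_simps)
      then have "norm (b - G z) \<le> e * t"
        using * B by (simp add: norm_divide divide_le_eq)
      then show "G z \<in> cball b (e * t)" by (simp add: dist_norm)
    qed
    ultimately obtain z where z: "z \<in> cball b (e * t)" "G z = z"
      using brouwer_ball[of "e * t" b G] e t by auto
    then have "F (u + t) z = F u a" using B by (simp add: G_def)
    then show ?thesis using z by (auto simp: b_def v_def dist_norm norm_minus_commute)
  qed
  then show ?thesis
    using d by (auto simp: eventually_at_right_field)
qed

text \<open>For \<open>z = a - t * a * m\<close> the weighted square
  \<open>(norm z)\<^sup>2 * (1 + u + t)\<close> has t-derivative
  \<open>(norm a)\<^sup>2 * (1 - 2 * (1 + u) * Re m)\<close> at 0. The hypothesis makes it negative,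
  which leaves room for an error proportional to \<open>t\<close>.\<close>

lemma eventually_norm_decreasing:
  fixes a m :: complex and u :: real
  assumes "a \<noteq> 0" "1 < 2 * (1 + u) * Re m" "0 \<le> u"
  obtains e where "0 < e"
    "\<forall>\<^sub>F t in at_right 0. \<forall>z. norm (z - (a - of_real t * (a * m))) \<le> e * t
        \<longrightarrow> (norm z)\<^sup>2 * (1 + u + t) \<le> (norm a)\<^sup>2 * (1 + u)"
proof -
  \<comment> \<open>Half of the excess of \<open>Re m\<close> over the critical value
    \<open>1 / (2 * (1 + u))\<close>: an error of relative size \<open>\<kappa> * t\<close> uses up
    only half of the available decrease.\<close>
  define \<kappa> where "\<kappa> = (Re m - 1 / (2 * (1 + u))) / 2"
  have \<kappa>_eq: "2 * \<kappa> * (1 + u) = Re m * (1 + u) - 1 / 2"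
    using assms by (simp add: \<kappa>_def field_simps)
  then have "0 < 2 * \<kappa> * (1 + u)" using assms by (simp add: algebra_simps)
  then have \<kappa>: "\<kappa> > 0" using assms by (simp add: zero_less_mult_iff)
  define g where "g t = (sqrt ((1 - t * Re m)\<^sup>2 + (t * Im m)\<^sup>2) + \<kappa> * t)\<^sup>2 * (1 + u + t)" for t
  have "DERIV g 0 :> 2 * (\<kappa> - Re m) * (1 + u) + 1"
    unfolding g_def by (auto intro!: derivative_eq_intros simp: field_simps)
  then have "\<exists>d>0. \<forall>t>0. t < d \<longrightarrow> g (0 + t) < g 0"
  proof (rule DERIV_neg_dec_right)
    show "2 * (\<kappa> - Re m) * (1 + u) + 1 < 0"
      using assms \<kappa>_eq by (simp add: algebra_simps)
  qed
  then obtain d where d: "d > 0" "\<And>t. 0 < t \<Longrightarrow> t < d \<Longrightarrow> g t < g 0"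
    by auto
  have "(norm z)\<^sup>2 * (1 + u + t) \<le> (norm a)\<^sup>2 * (1 + u)"
    if t: "0 < t" "t < d" and z: "norm (z - (a - of_real t * (a * m))) \<le> norm a * \<kappa> * t" for t z
  proof -
    have "norm (a - of_real t * (a * m)) = norm (a * (1 - of_real t * m))" by (simp add: algebra_simps)
    also have "\<dots> = norm a * norm (1 - of_real t * m)" by (rule norm_mult)
    also have "norm (1 - of_real t * m) = sqrt ((1 - t * Re m)\<^sup>2 + (t * Im m)\<^sup>2)"
      by (simp add: cmod_def)
    finally have "norm z \<le> norm a * sqrt ((1 - t * Re m)\<^sup>2 + (t * Im m)\<^sup>2) + norm a * \<kappa> * t"
      using z norm_triangle_sub[of z "a - of_real t * (a * m)"] by linarith
    then have "(norm z)\<^sup>2 \<le> (norm a * (sqrt ((1 - t * Re m)\<^sup>2 + (t * Im m)\<^sup>2) + \<kappa> * t))\<^sup>2"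
      by (intro power_mono) (auto simp: algebra_simps)
    then have "(norm z)\<^sup>2 * (1 + u + t) \<le> (norm a * (sqrt ((1 - t * Re m)\<^sup>2 + (t * Im m)\<^sup>2) + \<kappa> * t))\<^sup>2 * (1 + u + t)"
      using t assms by (intro mult_right_mono) auto
    also have "\<dots> = (norm a)\<^sup>2 * g t" by (simp add: g_def power_mult_distrib)
    also have "\<dots> \<le> (norm a)\<^sup>2 * g 0" using d(2)[OF t] by (intro mult_left_mono) auto
    finally show ?thesis by (simp add: g_def)
  qed
  then show ?thesis
    using assms \<kappa> d(1) that[of "norm a * \<kappa>"] by (auto simp: eventually_at_right_field)
qed

section \<open>Ahlfors' univalence criterion by a Loewner chain\<close>

locale ahlfors_criterion =
  fixes \<phi> :: "complex \<Rightarrow> complex" and c :: complex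
  assumes hol: "\<phi> holomorphic_on ball 0 1"
    and deriv_nz: "z \<in> ball 0 1 \<Longrightarrow> deriv \<phi> z \<noteq> 0"
    and c_le: "cmod c \<le> 1" and c_neq: "c \<noteq> -1"
    and criterion: "z \<in> ball 0 1 \<Longrightarrow>
      cmod (of_real (1 - (cmod z)\<^sup>2) * (z * deriv (deriv \<phi>) z / deriv \<phi> z) + c * of_real ((cmod z)\<^sup>2)) \<le> 1"
begin

text \<open>With \<open>u = exp (2 * t) - 1\<close> and \<open>\<zeta> = exp (- t) * z\<close>, the family \<open>chain\<close> is the Loewner chain
  \<open>\<phi> \<zeta> + (exp t - exp (- t)) * z * \<phi>' \<zeta> / (1 + c)\<close>; the disc \<open>cmod z < 1\<close> becomes
  \<open>(cmod \<zeta>)\<^sup>2 * (1 + u) < 1\<close>. Its Herglotz function is \<open>(1 - E) / (1 + E)\<close> for \<open>E = schwarz u \<zeta>\<close>.\<close>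

definition chain :: "real \<Rightarrow> complex \<Rightarrow> complex" where
  "chain u z = \<phi> z + of_real u / (1 + c) * (z * deriv \<phi> z)"

definition schwarz :: "real \<Rightarrow> complex \<Rightarrow> complex" where
  "schwarz u z = (c + of_real u * (z * deriv (deriv \<phi>) z / deriv \<phi> z)) / of_real (1 + u)"

text \<open>The divided difference of \<open>chain u\<close>, separated into two parts free of
  \<open>u\<close>; joint continuity in all three variables then reduces to that of
  \<open>divided_difference\<close>.\<close>

definition chain_quotient :: "real \<Rightarrow> complex \<Rightarrow> complex \<Rightarrow> complex" where
  "chain_quotient u a b =
     divided_difference \<phi> a b + of_real u / (1 + c) * divided_difference (\<lambda>z. z * deriv \<phi> z) a b"

lemma one_plus_c: "1 + c \<noteq> 0"
  using c_neq by (metis add_eq_0_iff)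

lemma hol_deriv: "deriv \<phi> holomorphic_on ball 0 1" "deriv (deriv \<phi>) holomorphic_on ball 0 1"
  using hol by (auto intro: holomorphic_deriv)

lemma has_deriv:
  assumes "z \<in> ball 0 1"
  shows "(\<phi> has_field_derivative deriv \<phi> z) (at z)"
    "(deriv \<phi> has_field_derivative deriv (deriv \<phi>) z) (at z)"
  using assms hol hol_deriv holomorphic_derivI open_ball by blast+

text \<open>\<open>schwarz u z\<close> is a convex combination of the expression in
  \<open>criterion\<close> and of \<open>c\<close>, both of modulus at most 1. The condition
  \<open>(cmod z)\<^sup>2 * (1 + u) \<le> 1\<close> says precisely that the weight of the former is
  at most 1.\<close>

lemma norm_schwarz_le:
  assumes u: "0 \<le> u" and z: "z \<in> ball 0 1" "(cmod z)\<^sup>2 * (1 + u) \<le> 1"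
  shows "cmod (schwarz u z) \<le> 1"
proof -
  define x where "x = (cmod z)\<^sup>2"
  define q where "q = z * deriv (deriv \<phi>) z / deriv \<phi> z"
  \<comment> \<open>The weight is forced by the coefficient of \<open>q\<close>:
    \<open>\<mu> * (1 - x) = u / (1 + u)\<close>.\<close>
  define \<mu> where "\<mu> = u / ((1 + u) * (1 - x))"
  have x: "0 \<le> x" "x < 1" using z(1) by (auto simp: x_def power_less_one_iff)
  have "u \<le> (1 + u) * (1 - x)" using z(2) by (simp add: x_def algebra_simps)
  then have \<mu>: "0 \<le> \<mu>" "\<mu> \<le> 1" using u x by (auto simp: \<mu>_def divide_le_eq)
  have "schwarz u z = of_real (u / (1 + u)) * q + of_real (1 - u / (1 + u)) * c"
  proof -
    have "1 - u / (1 + u) = 1 / (1 + u)" using u by (simp add: field_simps)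
    then show ?thesis by (simp add: schwarz_def q_def add_divide_distrib)
  qed
  also have "u / (1 + u) = \<mu> * (1 - x)" using u x by (simp add: \<mu>_def)
  also have "of_real (\<mu> * (1 - x)) * q + of_real (1 - \<mu> * (1 - x)) * c
      = of_real \<mu> * (of_real (1 - x) * q + c * of_real x) + of_real (1 - \<mu>) * c"
    by (simp add: algebra_simps)
  also have "cmod \<dots> \<le> \<mu> * cmod (of_real (1 - x) * q + c * of_real x) + (1 - \<mu>) * cmod c"
    using \<mu> by (intro norm_triangle_le) (simp add: norm_mult del: of_real_diff)
  also have "\<dots> \<le> \<mu> * 1 + (1 - \<mu>) * 1"
    using \<mu> c_le criterion[OF z(1)] by (intro add_mono mult_left_mono) (auto simp: x_def q_def)
  finally show ?thesis by simp
qed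

text \<open>If modulus 1 were reached inside the disc, the maximum principle would make
  \<open>schwarz u\<close> constant there; but its value at 0 is \<open>c / (1 + u)\<close>, of
  modulus below 1.\<close>

lemma norm_schwarz_less:
  assumes u: "0 < u" and z: "(cmod z)\<^sup>2 * (1 + u) < 1"
  shows "cmod (schwarz u z) < 1"
proof (rule ccontr)
  assume ge: "\<not> cmod (schwarz u z) < 1"
  define \<rho> where "\<rho> = sqrt (1 / (1 + u))"
  have \<rho>: "0 < \<rho>" "\<rho>\<^sup>2 = 1 / (1 + u)" "\<rho> < 1" using u by (auto simp: \<rho>_def)
  have mem: "w \<in> ball 0 \<rho> \<longleftrightarrow> (cmod w)\<^sup>2 * (1 + u) < 1" for w :: complex
  proof -
    have "w \<in> ball 0 \<rho> \<longleftrightarrow> (cmod w)\<^sup>2 < \<rho>\<^sup>2"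
      using \<rho>(1) by (auto intro: power2_less_imp_less power_strict_mono)
    then show ?thesis using u by (simp add: \<rho>(2) field_simps)
  qed
  have sub: "ball 0 \<rho> \<subseteq> ball (0 :: complex) 1" using \<rho> by (intro subset_ball) simp
  have "schwarz u constant_on ball 0 \<rho>"
  proof (rule maximum_modulus_principle)
    show "schwarz u holomorphic_on ball 0 \<rho>"
      unfolding schwarz_def using u sub deriv_nz
      by (intro holomorphic_intros holomorphic_on_subset[OF hol_deriv(1) sub]
          holomorphic_on_subset[OF hol_deriv(2) sub]) (auto simp flip: of_real_add)
    show "z \<in> ball 0 \<rho>" using mem z by blast
    show "cmod (schwarz u w) \<le> cmod (schwarz u z)" if "w \<in> ball 0 \<rho>" for w
      using norm_schwarz_le[of u w] that sub mem[of w] u ge by force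
  qed auto
  moreover have "z \<in> ball 0 \<rho>" "0 \<in> ball (0::complex) \<rho>" using mem z \<rho> by auto
  ultimately have "schwarz u z = schwarz u 0" unfolding constant_on_def by metis
  moreover have "cmod (schwarz u 0) = cmod c / (1 + u)"
    using u by (simp add: schwarz_def norm_divide del: of_real_add)
  ultimately have "cmod (schwarz u z) = cmod c / (1 + u)" by simp
  also have "\<dots> < 1" using c_le u by (simp add: divide_less_eq)
  finally show False using ge by simp
qed

text \<open>The left side is the z-derivative of \<open>chain u\<close>; in the factored form it can
  vanish only where \<open>schwarz u z = -1\<close>.\<close>

lemma chain_derivative_eq:
  assumes "z \<in> ball 0 1" "0 \<le> u"
  shows "deriv \<phi> z + of_real u / (1 + c) * (deriv \<phi> z + z * deriv (deriv \<phi>) z)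
    = deriv \<phi> z * of_real (1 + u) * (1 + schwarz u z) / (1 + c)"
proof -
  define v where "v = complex_of_real u"
  have "of_real (1 + u) \<noteq> (0 :: complex)" using assms(2) by (simp del: of_real_add)
  then have v: "1 + v \<noteq> 0" by (simp add: v_def)
  have "(1 + v) * (1 + schwarz u z) = 1 + v + c + v * (z * deriv (deriv \<phi>) z / deriv \<phi> z)"
  proof -
    have "(1 + v) * schwarz u z = c + v * (z * deriv (deriv \<phi>) z / deriv \<phi> z)"
      using v by (simp add: schwarz_def v_def)
    then show ?thesis by (simp add: distrib_left)
  qed
  then have "deriv \<phi> z * ((1 + v) * (1 + schwarz u z))
      = (1 + c) * deriv \<phi> z + v * (deriv \<phi> z + z * deriv (deriv \<phi>) z)"
    using deriv_nz[OF assms(1)] by (simp add: algebra_simps)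
  then show ?thesis
    using one_plus_c by (simp add: v_def add_divide_distrib mult.assoc)
qed

lemma chain_has_derivative:
  assumes "a \<in> ball 0 1" "0 \<le> u"
  shows "((\<lambda>(t, z). chain t z) has_derivative
    (\<lambda>(t, z). a * deriv \<phi> a / (1 + c) * of_real t
       + deriv \<phi> a * of_real (1 + u) * (1 + schwarz u a) / (1 + c) * z)) (at (u, a))"
proof -
  have snd: "(snd has_derivative snd) (at (u, a))"
    by (intro has_derivative_snd has_derivative_ident)
  have D: "((\<lambda>p. f (snd p)) has_derivative (\<lambda>p. f' * snd p)) (at (u, a))"
    if "(f has_field_derivative f') (at a)" for f f'
    using has_derivative_compose[OF snd, of f "(*) f'"] that by (simp add: has_field_derivative_def)
  have "((\<lambda>p. chain (fst p) (snd p)) has_derivative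
    (\<lambda>p. a * deriv \<phi> a / (1 + c) * of_real (fst p)
       + (deriv \<phi> a + of_real u / (1 + c) * (deriv \<phi> a + a * deriv (deriv \<phi>) a)) * snd p)) (at (u, a))"
    unfolding chain_def
    by (rule derivative_eq_intros D[OF has_deriv(1)] D[OF has_deriv(2)] assms(1) one_plus_c refl)+
      (simp add: algebra_simps add_divide_distrib)
  then show ?thesis
    unfolding chain_derivative_eq[OF assms] case_prod_beta .
qed

text \<open>A point that keeps its image while the parameter grows moves with velocity minus the
  quotient of the partial derivatives of the chain. In this quotient \<open>deriv \<phi> a\<close>
  and \<open>1 + c\<close> cancel. The value \<open>u = 0\<close> is included because the final
  argument starts there.\<close>

lemma chain_solution:
  assumes a: "a \<in> ball 0 1" and u: "0 \<le> u" "1 + schwarz u a \<noteq> 0" and "0 < e" "0 < d"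
  shows "\<forall>\<^sub>F t in at_right 0. \<exists>z. chain (u + t) z = chain u a \<and> cmod (z - a) < d \<and>
    cmod (z - (a - of_real t * (a * (1 / (of_real (1 + u) * (1 + schwarz u a)))))) \<le> e * t"
proof -
  define m where "m = 1 / (of_real (1 + u) * (1 + schwarz u a))"
  define A where "A = a * deriv \<phi> a / (1 + c)"
  define B where "B = deriv \<phi> a * of_real (1 + u) * (1 + schwarz u a) / (1 + c)"
  have u1: "of_real (1 + u) \<noteq> (0 :: complex)" using u(1) by (simp del: of_real_add)
  have B: "B \<noteq> 0" using deriv_nz[OF a] one_plus_c u u1 by (simp add: B_def del: of_real_add)
  have AB: "A / B = a * m"
    using deriv_nz[OF a] one_plus_c u u1 by (simp add: A_def B_def m_def del: of_real_add)
  have "\<forall>\<^sub>F t in at_right 0. \<exists>z. chain (u + t) z = chain u a \<and> cmod (z - (a - of_real t * (A / B))) \<le> e * t"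
  proof (rule implicit_solution_first_order[where S = "ball 0 1"])
    show "((\<lambda>(t, z). chain t z) has_derivative (\<lambda>(t, z). A * of_real t + B * z)) (at (u, a))"
      unfolding A_def B_def by (rule chain_has_derivative[OF a u(1)])
    show "continuous_on (ball 0 1) (chain t)" for t
      unfolding chain_def using hol hol_deriv(1) one_plus_c
      by (intro continuous_intros holomorphic_on_imp_continuous_on) auto
  qed (use a B \<open>0 < e\<close> in auto)
  moreover have "((\<lambda>t. t * (cmod (a * m) + e)) \<longlongrightarrow> 0) (at_right 0)"
    by (auto intro!: tendsto_eq_intros)
  then have "\<forall>\<^sub>F t in at_right 0. t * (cmod (a * m) + e) < d"
    using \<open>0 < d\<close> by (rule order_tendstoD)
  ultimately show ?thesis
    using eventually_at_right_less[of "0 :: real"]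
  proof eventually_elim
    case (elim t)
    then obtain z where z: "chain (u + t) z = chain u a" "cmod (z - (a - of_real t * (a * m))) \<le> e * t"
      by (auto simp: AB)
    have "cmod (z - a) = cmod ((z - (a - of_real t * (a * m))) - of_real t * (a * m))" by simp
    also have "\<dots> \<le> cmod (z - (a - of_real t * (a * m))) + cmod (of_real t * (a * m))"
      by (rule norm_triangle_ineq4)
    also have "\<dots> \<le> e * t + t * cmod (a * m)"
      using z(2) elim(3) by (simp add: norm_mult)
    also have "\<dots> < d" using elim(2) by (simp add: algebra_simps)
    finally show ?case using z unfolding m_def by blast
  qed
qed

text \<open>Since \<open>schwarz u a\<close> has modulus below 1, the number
  \<open>w = 1 + schwarz u a\<close> lies in the disc of radius 1 about 1, which inversion maps to
  the half-plane \<open>Re > 1 / 2\<close>. This is the condition under which the weighted modulus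
  decreases.\<close>

lemma chain_solution_inward:
  assumes u: "0 < u" and a: "(cmod a)\<^sup>2 * (1 + u) < 1" and d: "0 < d"
  shows "\<forall>\<^sub>F t in at_right 0. \<exists>z. chain (u + t) z = chain u a \<and> cmod (z - a) < d \<and>
    (cmod z)\<^sup>2 * (1 + u + t) \<le> (cmod a)\<^sup>2 * (1 + u)"
proof (cases "a = 0")
  case True
  \<comment> \<open>The origin has the image \<open>\<phi> 0\<close> for every parameter, so it
    stays where it is.\<close>
  then show ?thesis using d by (auto intro!: always_eventually exI[of _ 0] simp: chain_def)
next
  case False
  define m where "m = 1 / (of_real (1 + u) * (1 + schwarz u a))"
  define w where "w = 1 + schwarz u a"
  have E: "cmod (schwarz u a) < 1" by (rule norm_schwarz_less[OF u a])
  have "(cmod (schwarz u a))\<^sup>2 < 1" using E by (simp add: power_less_one_iff)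
  \<comment> \<open>This is \<open>cmod (w - 1) < 1\<close>, squared and expanded; division by
    \<open>(cmod w)\<^sup>2\<close> will give \<open>Re (1 / w) > 1 / 2\<close>.\<close>
  then have w: "(cmod w)\<^sup>2 < 2 * Re w"
    unfolding cmod_power2 w_def by (simp add: power2_eq_square algebra_simps)
  then have "w \<noteq> 0" by auto
  have "m = of_real (1 / (1 + u)) * (1 / w)"
    by (simp add: m_def w_def)
  then have "Re m = 1 / (1 + u) * Re (1 / w)"
    by (simp only: times_complex.simps Re_complex_of_real Im_complex_of_real)
  then have "(1 + u) * Re m = Re (1 / w)" using u by simp
  also have "\<dots> = Re w / (cmod w)\<^sup>2" by (simp add: Re_divide cmod_power2)
  also have "\<dots> > 1 / 2" using w \<open>w \<noteq> 0\<close> by (simp add: field_simps)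
  finally have "1 < 2 * (1 + u) * Re m" by (simp only: mult.assoc)
  then obtain e where e: "0 < e"
    "\<forall>\<^sub>F t in at_right 0. \<forall>z. cmod (z - (a - of_real t * (a * m))) \<le> e * t
        \<longrightarrow> (cmod z)\<^sup>2 * (1 + u + t) \<le> (cmod a)\<^sup>2 * (1 + u)"
    using eventually_norm_decreasing[OF False, of u m] u by auto
  have "(cmod a)\<^sup>2 * 1 \<le> (cmod a)\<^sup>2 * (1 + u)" using u by (intro mult_left_mono) auto
  then have "(cmod a)\<^sup>2 < 1" using a by linarith
  then have "a \<in> ball 0 1" by (simp add: power_less_one_iff)
  then have "\<forall>\<^sub>F t in at_right 0. \<exists>z. chain (u + t) z = chain u a \<and> cmod (z - a) < d \<and>
    cmod (z - (a - of_real t * (a * m))) \<le> e * t"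
    unfolding m_def using u e(1) d \<open>w \<noteq> 0\<close> by (intro chain_solution) (auto simp: w_def)
  then show ?thesis using e(2) by eventually_elim blast
qed

lemma chain_quotient_eq_0_iff:
  assumes "a \<noteq> b"
  shows "chain_quotient u a b = 0 \<longleftrightarrow> chain u a = chain u b"
proof -
  have "chain_quotient u a b = (chain u a - chain u b) / (a - b)"
    using assms by (simp add: chain_quotient_def divided_difference_def chain_def diff_divide_distrib
        add_divide_distrib right_diff_distrib)
  then show ?thesis using assms by simp
qed

lemma deriv_z_deriv:
  assumes "a \<in> ball 0 1"
  shows "deriv (\<lambda>z. z * deriv \<phi> z) a = deriv \<phi> a + a * deriv (deriv \<phi>) a"
  by (rule DERIV_imp_deriv) (auto intro!: derivative_eq_intros has_deriv[OF assms])

text \<open>The diagonal value is the derivative of \<open>chain u\<close>, so a zero of the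
  quotient always comes from two distinct points.\<close>

lemma chain_quotient_diagonal:
  assumes a: "a \<in> ball 0 1" and "0 \<le> u" "1 + schwarz u a \<noteq> 0"
  shows "chain_quotient u a a \<noteq> 0"
proof -
  have "chain_quotient u a a = deriv \<phi> a * of_real (1 + u) * (1 + schwarz u a) / (1 + c)"
    unfolding chain_derivative_eq[OF a \<open>0 \<le> u\<close>, symmetric]
    by (simp add: chain_quotient_def divided_difference_def deriv_z_deriv[OF a])
  then show ?thesis
    using assms deriv_nz[OF a] one_plus_c by (simp del: of_real_add)
qed

lemma continuous_divided_differences:
  "continuous_on (ball 0 1 \<times> ball 0 1) (\<lambda>p. divided_difference \<phi> (fst p) (snd p))"
  "continuous_on (ball 0 1 \<times> ball 0 1) (\<lambda>p. divided_difference (\<lambda>z. z * deriv \<phi> z) (fst p) (snd p))"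
  using hol hol_deriv(1) by (intro continuous_on_divided_difference holomorphic_intros; simp)+

text \<open>For large \<open>u\<close> both points are close to 0, where the divided differences of
  \<open>\<phi>\<close> and of \<open>z * deriv \<phi> z\<close> are both close to
  \<open>deriv \<phi> 0\<close>; the factor \<open>u / (1 + c)\<close> then makes the second summand
  dominate.\<close>

lemma chain_quotient_large:
  obtains U where "0 < U"
    "\<And>u a b. U \<le> u \<Longrightarrow> (cmod a)\<^sup>2 * (1 + u) < 1 \<Longrightarrow> (cmod b)\<^sup>2 * (1 + u) < 1 \<Longrightarrow> chain_quotient u a b \<noteq> 0"
proof -
  define D0 where "D0 p = divided_difference \<phi> (fst p) (snd p)" for p
  define D1 where "D1 p = divided_difference (\<lambda>z. z * deriv \<phi> z) (fst p) (snd p)" for p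
  define m where "m = cmod (deriv \<phi> 0)"
  have m: "m > 0" using deriv_nz[of 0] by (simp add: m_def)
  have "isCont D0 (0, 0)" "isCont D1 (0, 0)"
    using continuous_divided_differences unfolding D0_def D1_def
    by (auto simp: continuous_on_eq_continuous_at open_Times)
  then have "((\<lambda>p. cmod (D0 p)) \<longlongrightarrow> cmod (D0 (0, 0))) (nhds (0, 0))"
    "((\<lambda>p. cmod (D1 p)) \<longlongrightarrow> cmod (D1 (0, 0))) (nhds (0, 0))"
    by (auto intro!: tendsto_norm simp: isCont_def tendsto_at_iff_tendsto_nhds)
  moreover have "cmod (D0 (0, 0)) < 2 * m" "m / 2 < cmod (D1 (0, 0))"
    using m by (auto simp: D0_def D1_def divided_difference_def deriv_z_deriv m_def)
  ultimately have "\<forall>\<^sub>F p in nhds (0, 0). cmod (D0 p) < 2 * m" "\<forall>\<^sub>F p in nhds (0, 0). m / 2 < cmod (D1 p)"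
    using order_tendstoD by blast+
  then have "\<forall>\<^sub>F p in nhds (0, 0). cmod (D0 p) < 2 * m \<and> m / 2 < cmod (D1 p)"
    by (rule eventually_conj)
  then obtain d where d: "d > 0" "\<And>p. dist p (0, 0) < d \<Longrightarrow> cmod (D0 p) < 2 * m \<and> m / 2 < cmod (D1 p)"
    unfolding eventually_nhds_metric by blast
  \<comment> \<open>The first bound gives \<open>u / cmod (1 + c) \<ge> 4\<close>, lifting
    \<open>m / 2\<close> to \<open>2 * m\<close>; the second puts both points within
    \<open>d / 2\<close> of 0.\<close>
  define U where "U = max (4 * cmod (1 + c)) (4 / d\<^sup>2)"
  show ?thesis
  proof
    show "0 < U" using d(1) by (simp add: U_def less_max_iff_disj)
    fix u a b assume u: "U \<le> u" and ab: "(cmod a)\<^sup>2 * (1 + u) < 1" "(cmod b)\<^sup>2 * (1 + u) < 1"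
    have small: "cmod x < d / 2" if "(cmod x)\<^sup>2 * (1 + u) < 1" for x
    proof (rule power2_less_imp_less)
      have "(cmod x)\<^sup>2 * (4 / d\<^sup>2) \<le> (cmod x)\<^sup>2 * (1 + u)"
        using u by (intro mult_left_mono) (auto simp: U_def)
      then have "(cmod x)\<^sup>2 * (4 / d\<^sup>2) < 1" using that by linarith
      then show "(cmod x)\<^sup>2 < (d / 2)\<^sup>2" using d(1) by (simp add: field_simps)
    qed (use d in auto)
    have "dist (a, b) (0, 0) \<le> cmod a + cmod b"
      by (simp add: dist_Pair_Pair sqrt_sum_squares_le_sum)
    then have "dist (a, b) (0, 0) < d" using small[OF ab(1)] small[OF ab(2)] by linarith
    then have D: "cmod (D0 (a, b)) < 2 * m" "m / 2 < cmod (D1 (a, b))" using d(2) by auto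
    have c1: "cmod (1 + c) > 0" using one_plus_c by simp
    have "2 * m = (4 * cmod (1 + c)) / cmod (1 + c) * (m / 2)" using one_plus_c by simp
    also have "\<dots> \<le> u / cmod (1 + c) * (m / 2)"
      using u m c1 by (intro mult_right_mono divide_right_mono) (auto simp: U_def)
    also have "\<dots> \<le> u / cmod (1 + c) * cmod (D1 (a, b))"
      using D(2) u \<open>0 < U\<close> by (intro mult_left_mono) auto
    also have "\<dots> = cmod (of_real u / (1 + c) * D1 (a, b))"
      using u \<open>0 < U\<close> by (simp add: norm_mult norm_divide)
    finally have "cmod (D0 (a, b)) < cmod (of_real u / (1 + c) * D1 (a, b))" using D(1) by linarith
    moreover have "chain_quotient u a b = D0 (a, b) + of_real u / (1 + c) * D1 (a, b)"
      by (simp add: chain_quotient_def D0_def D1_def)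
    ultimately show "chain_quotient u a b \<noteq> 0"
      by (metis add_eq_0_iff less_irrefl norm_minus_cancel)
  qed
qed

text \<open>An extremal argument: the collisions with weighted squares at most \<open>R\<close> form
  a compact set, so one of them has the largest parameter. Moving its two points inwards produces a
  collision with a larger parameter in the same set.\<close>

lemma chain_injective:
  assumes u0: "0 < u0"
  shows "inj_on (chain u0) {z. (cmod z)\<^sup>2 * (1 + u0) < 1}"
proof (rule inj_onI, rule ccontr)
  fix a0 b0
  assume ab0: "a0 \<in> {z. (cmod z)\<^sup>2 * (1 + u0) < 1}" "b0 \<in> {z. (cmod z)\<^sup>2 * (1 + u0) < 1}"
    and eq0: "chain u0 a0 = chain u0 b0" and "a0 \<noteq> b0"
  obtain U where U: "0 < U" "\<And>u a b. U \<le> u \<Longrightarrow> (cmod a)\<^sup>2 * (1 + u) < 1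
      \<Longrightarrow> (cmod b)\<^sup>2 * (1 + u) < 1 \<Longrightarrow> chain_quotient u a b \<noteq> 0"
    using chain_quotient_large by blast
  define R where "R = max ((cmod a0)\<^sup>2 * (1 + u0)) ((cmod b0)\<^sup>2 * (1 + u0))"
  have R: "0 \<le> R" "R < 1" using ab0 u0 by (auto simp: R_def le_max_iff_disj)
  define C where "C = {u0..U} \<times> cball (0 :: complex) (sqrt R) \<times> cball (0 :: complex) (sqrt R)"
  have C: "compact C" unfolding C_def by (intro compact_Times) auto
  \<comment> \<open>Collisions are recorded as zeros of \<open>chain_quotient\<close>, a closed
    condition, rather than as pairs of distinct points, which would not be closed.\<close>
  define \<Psi> where "\<Psi> = (\<lambda>(u, a, b). (chain_quotient u a b, (cmod a)\<^sup>2 * (1 + u), (cmod b)\<^sup>2 * (1 + u)))"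
  define K where "K = {p \<in> C. \<Psi> p \<in> {0} \<times> {..R} \<times> {..R}}"
  have Cball: "snd p \<in> ball 0 1 \<times> ball 0 1" if "p \<in> C" for p
  proof -
    have "sqrt R < 1" using R by simp
    then have "cball 0 (sqrt R) \<subseteq> ball (0 :: complex) 1" by (simp add: cball_subset_ball_iff)
    then have "cball 0 (sqrt R) \<times> cball 0 (sqrt R) \<subseteq> ball (0 :: complex) 1 \<times> ball (0 :: complex) 1"
      by (intro Sigma_mono)
    moreover have "snd p \<in> cball 0 (sqrt R) \<times> cball 0 (sqrt R)" using that by (auto simp: C_def)
    ultimately show ?thesis by (rule subsetD)
  qed
  have snd: "continuous_on C snd" by (rule continuous_on_snd[OF continuous_on_id])
  have "snd ` C \<subseteq> ball 0 1 \<times> ball 0 1" using Cball by (rule image_subsetI)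
  note D = continuous_on_compose2[OF continuous_divided_differences(1) snd this]
    continuous_on_compose2[OF continuous_divided_differences(2) snd this]
  have "continuous_on C \<Psi>"
    unfolding \<Psi>_def case_prod_beta chain_quotient_def by (intro continuous_intros D) (simp add: one_plus_c)
  moreover have "closed ({0 :: complex} \<times> {..R} \<times> {..R})" by (intro closed_Times) auto
  ultimately have "closed (\<Psi> -` ({0} \<times> {..R} \<times> {..R}) \<inter> C)"
    using continuous_on_closed_vimage[OF compact_imp_closed[OF C], of \<Psi>] by blast
  moreover have "K = C \<inter> (\<Psi> -` ({0} \<times> {..R} \<times> {..R}) \<inter> C)" by (auto simp: K_def)
  ultimately have "compact K" using C by (simp only: compact_Int_closed)
  have inK: "(u, a, b) \<in> K"
    if "u0 \<le> u" "(cmod a)\<^sup>2 * (1 + u) \<le> R" "(cmod b)\<^sup>2 * (1 + u) \<le> R" "a \<noteq> b" "chain u a = chain u b" for u a b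
  proof -
    have Q: "chain_quotient u a b = 0" using that by (simp add: chain_quotient_eq_0_iff)
    \<comment> \<open>Absence of collisions for large parameters is what bounds the parameter, and
      hence gives compactness.\<close>
    then have "u < U" using U(2)[of u a b] that R by fastforce
    moreover have "cmod x \<le> sqrt R" if "(cmod x)\<^sup>2 * (1 + u) \<le> R" for x
    proof -
      have "(cmod x)\<^sup>2 * 1 \<le> (cmod x)\<^sup>2 * (1 + u)"
        using \<open>u0 \<le> u\<close> u0 by (intro mult_left_mono) auto
      then show ?thesis using that by (intro real_le_rsqrt) linarith
    qed
    ultimately show ?thesis using that Q by (auto simp: K_def C_def \<Psi>_def)
  qed
  have "(u0, a0, b0) \<in> K"
    using eq0 \<open>a0 \<noteq> b0\<close> by (intro inK) (auto simp: R_def)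
  then obtain p where p: "p \<in> K" "\<And>p'. p' \<in> K \<Longrightarrow> fst p' \<le> fst p"
    using continuous_attains_sup[OF \<open>compact K\<close>, of fst] continuous_on_fst[OF continuous_on_id] by blast
  obtain u a b where [simp]: "p = (u, a, b)" by (cases p)
  have u: "u0 \<le> u" and a: "(cmod a)\<^sup>2 * (1 + u) \<le> R" and b: "(cmod b)\<^sup>2 * (1 + u) \<le> R"
    and Q: "chain_quotient u a b = 0"
    using p(1) by (auto simp: K_def C_def \<Psi>_def)
  have "a \<in> ball 0 1" using Cball[of p] p(1) by (auto simp: K_def)
  have "cmod (schwarz u a) < 1" using u u0 a R by (intro norm_schwarz_less) auto
  then have "1 + schwarz u a \<noteq> 0"
    by (metis add_eq_0_iff less_irrefl norm_minus_cancel norm_one)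
  then have "a \<noteq> b" using chain_quotient_diagonal[OF \<open>a \<in> ball 0 1\<close>, of u] Q u u0 by auto
  then have eq: "chain u a = chain u b" using Q by (simp add: chain_quotient_eq_0_iff)
  \<comment> \<open>Points that move by less than half their distance cannot meet.\<close>
  define d where "d = cmod (a - b) / 2"
  have "d > 0" using \<open>a \<noteq> b\<close> by (simp add: d_def)
  have "\<forall>\<^sub>F t in at_right 0. \<exists>z. chain (u + t) z = chain u x \<and> cmod (z - x) < d \<and>
    (cmod z)\<^sup>2 * (1 + u + t) \<le> (cmod x)\<^sup>2 * (1 + u)" if "x \<in> {a, b}" for x
    using that u u0 a b R \<open>d > 0\<close> by (intro chain_solution_inward) auto
  then have "\<forall>\<^sub>F t in at_right 0. \<forall>x\<in>{a, b}. \<exists>z. chain (u + t) z = chain u x \<and> cmod (z - x) < d \<and>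
    (cmod z)\<^sup>2 * (1 + u + t) \<le> (cmod x)\<^sup>2 * (1 + u)"
    by (simp add: eventually_conj_iff)
  moreover have "\<forall>\<^sub>F t in at_right 0. 0 < (t :: real)" by (rule eventually_at_right_less)
  ultimately have "\<forall>\<^sub>F t in at_right (0 :: real). False"
  proof eventually_elim
    case (elim t)
    then obtain a' b' where a': "chain (u + t) a' = chain u a" "cmod (a' - a) < d"
        "(cmod a')\<^sup>2 * (1 + u + t) \<le> (cmod a)\<^sup>2 * (1 + u)"
      and b': "chain (u + t) b' = chain u b" "cmod (b' - b) < d"
        "(cmod b')\<^sup>2 * (1 + u + t) \<le> (cmod b)\<^sup>2 * (1 + u)"
      by auto
    have "a' \<noteq> b'"
    proof
      assume "a' = b'"
      then have "cmod (a - b) \<le> cmod (a' - a) + cmod (b' - b)"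
        using norm_triangle_ineq4[of "b' - b" "a' - a"] by simp
      then show False using a' b' by (simp add: d_def)
    qed
    then have "(u + t, a', b') \<in> K"
      using a' b' a b eq u elim(2) by (intro inK) (auto simp: add.assoc)
    then show False using p(2) elim(2) by force
  qed
  then show False by simp
qed

text \<open>At parameter 0 the value of \<open>schwarz\<close> is \<open>c\<close>, possibly of
  modulus 1, so inward motion is not guaranteed. It is enough to follow the two points to a small
  positive parameter \<open>t\<close>: they stay distinct and in the disc of radius
  \<open>r < 1\<close>, where \<open>chain t\<close> is injective once
  \<open>r\<^sup>2 * (1 + t) < 1\<close>.\<close>

theorem univalent: "inj_on \<phi> (ball 0 1)"
proof (rule inj_onI, rule ccontr)
  fix a b assume ab: "a \<in> ball 0 1" "b \<in> ball 0 1" "\<phi> a = \<phi> b" "a \<noteq> b"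
  define r where "r = (1 + max (cmod a) (cmod b)) / 2"
  have r: "cmod a < r" "cmod b < r" "r < 1" using ab by (auto simp: r_def)
  have "0 \<le> r" using r(1) norm_ge_zero[of a] by linarith
  define d where "d = min (min (r - cmod a) (r - cmod b)) (cmod (a - b) / 2)"
  have d: "d > 0" using ab r by (simp add: d_def)
  have "\<forall>\<^sub>F t in at_right 0. \<exists>z. chain t z = \<phi> x \<and> cmod (z - x) < d" if "x \<in> {a, b}" for x
  proof -
    have "\<forall>\<^sub>F t in at_right 0. \<exists>z. chain (0 + t) z = chain 0 x \<and> cmod (z - x) < d \<and>
      cmod (z - (x - of_real t * (x * (1 / (of_real (1 + 0) * (1 + schwarz 0 x)))))) \<le> 1 * t"
      using that ab d one_plus_c by (intro chain_solution) (auto simp: schwarz_def)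
    then show ?thesis by eventually_elim (auto simp: chain_def)
  qed
  then have "\<forall>\<^sub>F t in at_right 0. \<forall>x\<in>{a, b}. \<exists>z. chain t z = \<phi> x \<and> cmod (z - x) < d"
    by (simp add: eventually_conj_iff)
  moreover have "\<forall>\<^sub>F t in at_right 0. 0 < (t :: real)" by (rule eventually_at_right_less)
  moreover have "r\<^sup>2 < 1" using r \<open>0 \<le> r\<close> by (simp add: power_less_one_iff)
  have "((\<lambda>t. r\<^sup>2 * (1 + t)) \<longlongrightarrow> r\<^sup>2) (at_right 0)"
    by (auto intro!: tendsto_eq_intros)
  then have "\<forall>\<^sub>F t in at_right 0. r\<^sup>2 * (1 + t) < 1"
    using \<open>r\<^sup>2 < 1\<close> by (rule order_tendstoD)
  ultimately have "\<forall>\<^sub>F t in at_right (0::real). False"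
  proof eventually_elim
    case (elim t)
    then obtain a' b' where a': "chain t a' = \<phi> a" "cmod (a' - a) < d"
      and b': "chain t b' = \<phi> b" "cmod (b' - b) < d" by auto
    have "a' \<noteq> b'"
    proof
      assume "a' = b'"
      then have "cmod (a - b) \<le> cmod (a' - a) + cmod (b' - b)"
        using norm_triangle_ineq4[of "b' - b" "a' - a"] by simp
      then show False using a' b' by (simp add: d_def)
    qed
    moreover have "(cmod x)\<^sup>2 * (1 + t) < 1" if "cmod x \<le> r" for x
    proof -
      have "(cmod x)\<^sup>2 * (1 + t) \<le> r\<^sup>2 * (1 + t)"
        using that elim(2) by (intro mult_right_mono power_mono) auto
      then show ?thesis using elim(3) by simp
    qed
    moreover have "cmod a' \<le> r" "cmod b' \<le> r"
      using a'(2) b'(2) norm_triangle_sub[of a' a] norm_triangle_sub[of b' b] by (auto simp: d_def)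
    ultimately show False
      using chain_injective[OF elim(2)] a'(1) b'(1) ab(3) by (auto simp: inj_on_def)
  qed
  then show False by simp
qed

end

section \<open>Reduction of the logharmonic mapping to a family of analytic functions\<close>

text \<open>Over the common denominator the numerator becomes
  \<open>l + cnj w = l * cnj (1 + l * w)\<close>, whose modulus cancels that of the factor
  \<open>1 + l * w\<close> below.\<close>

lemma norm_pre_schwarzian_term:
  assumes "cmod l = 1" "cmod w < 1"
  shows "cmod (l / (1 + l * w) + cnj w / of_real (1 - (cmod w)\<^sup>2)) = 1 / (1 - (cmod w)\<^sup>2)"
proof -
  have "cmod (l * w) < 1" using assms by (simp add: norm_mult)
  then have nz: "1 + l * w \<noteq> 0"
    by (metis add_eq_0_iff less_irrefl norm_minus_cancel norm_one)
  have pos: "0 < 1 - (cmod w)\<^sup>2" using assms(2) by (simp add: power_less_one_iff)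
  then have nz': "complex_of_real (1 - (cmod w)\<^sup>2) \<noteq> 0" by (simp del: of_real_diff)
  have l: "l * cnj l = 1" using complex_norm_square[of l] assms(1) by simp
  have "l / (1 + l * w) + cnj w / of_real (1 - (cmod w)\<^sup>2)
      = (l * of_real (1 - (cmod w)\<^sup>2) + cnj w * (1 + l * w)) / ((1 + l * w) * of_real (1 - (cmod w)\<^sup>2))"
    using nz nz' by (simp add: add_frac_eq del: of_real_diff)
  also have "l * of_real (1 - (cmod w)\<^sup>2) + cnj w * (1 + l * w) = l + cnj w"
    by (simp add: algebra_simps complex_norm_square del: of_real_power flip: of_real_power)
  also have "\<dots> = l * cnj (1 + l * w)" using l by (simp add: algebra_simps)
  also have "cmod (l * cnj (1 + l * w) / ((1 + l * w) * of_real (1 - (cmod w)\<^sup>2)))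
      = cmod (1 + l * w) / (cmod (1 + l * w) * \<bar>1 - (cmod w)\<^sup>2\<bar>)"
    unfolding norm_divide norm_mult complex_mod_cnj norm_of_real assms(1) by simp
  also have "\<dots> = 1 / (1 - (cmod w)\<^sup>2)" using nz pos by simp
  finally show ?thesis .
qed

text \<open>From \<open>L' = g' / g = \<omega> * h' / h\<close> one gets
  \<open>\<phi>' = exp (l * L) * h' * (1 + l * \<omega>)\<close>. Its logarithmic derivative is the
  pre-Schwarzian derivative plus two corrections, which the last two summands of
  \<open>criterion_lhs\<close> absorb.\<close>

lemma ahlfors_le_logharmonic_criterion:
  assumes h: "h holomorphic_on S" "\<And>z. z \<in> S \<Longrightarrow> h z \<noteq> 0" "\<And>z. z \<in> S \<Longrightarrow> deriv h z \<noteq> 0"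
    and L: "L holomorphic_on S" and g: "\<And>z. z \<in> S \<Longrightarrow> g z = exp (L z)"
    and \<omega>: "\<And>z. z \<in> S \<Longrightarrow> cmod (lh_dilatation h g z) < 1"
    and S: "open S" and z: "z \<in> S" "cmod z < 1" and l: "cmod l = 1"
  defines "\<phi> \<equiv> \<lambda>z. h z * exp (l * L z)"
  shows "deriv \<phi> z \<noteq> 0"
    and "cmod (of_real (1 - (cmod z)\<^sup>2) * (z * deriv (deriv \<phi>) z / deriv \<phi> z) + c * of_real ((cmod z)\<^sup>2))
      \<le> criterion_lhs h g c z"
proof -
  define \<omega> where "\<omega> = lh_dilatation h g"
  note dh = holomorphic_derivI[OF h(1) S] and dL = holomorphic_derivI[OF L S]
    and dh' = holomorphic_derivI[OF holomorphic_deriv[OF h(1) S] S]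
  have dg: "deriv g x = deriv L x * exp (L x)" if "x \<in> S" for x
  proof (rule DERIV_imp_deriv)
    have "((\<lambda>x. exp (L x)) has_field_derivative deriv L x * exp (L x)) (at x)"
      using dL[OF that] by (auto intro!: derivative_eq_intros)
    then show "(g has_field_derivative deriv L x * exp (L x)) (at x)"
      by (rule has_field_derivative_transform_within_open[OF _ S that]) (simp add: g)
  qed
  have \<omega>_eq: "\<omega> x = deriv L x * h x / deriv h x" if "x \<in> S" for x
    using that by (simp add: \<omega>_def lh_dilatation_def dg g)
  have "(\<lambda>x. deriv L x * h x / deriv h x) holomorphic_on S"
    using h L S by (intro holomorphic_intros) auto
  then have "\<omega> holomorphic_on S" by (simp add: \<omega>_eq cong: holomorphic_cong)
  note d\<omega> = holomorphic_derivI[OF this S]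
  have nz: "1 + l * \<omega> x \<noteq> 0" if "x \<in> S" for x
  proof -
    have "cmod (l * \<omega> x) < 1" using \<omega>[OF that] l by (simp add: norm_mult \<omega>_def)
    then show ?thesis by (metis add_eq_0_iff less_irrefl norm_minus_cancel norm_one)
  qed
  have d\<phi>: "deriv \<phi> x = exp (l * L x) * (deriv h x * (1 + l * \<omega> x))" if "x \<in> S" for x
  proof (rule DERIV_imp_deriv)
    have "(\<phi> has_field_derivative h x * (l * deriv L x * exp (l * L x)) + deriv h x * exp (l * L x)) (at x)"
      unfolding \<phi>_def using that by (auto intro!: derivative_eq_intros dh dL)
    moreover have "deriv h x * \<omega> x = deriv L x * h x" using that h by (simp add: \<omega>_eq)
    then have "h x * (l * deriv L x * exp (l * L x)) + deriv h x * exp (l * L x)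
        = exp (l * L x) * (deriv h x * (1 + l * \<omega> x))"
      by (simp add: algebra_simps)
    ultimately show "(\<phi> has_field_derivative exp (l * L x) * (deriv h x * (1 + l * \<omega> x))) (at x)" by simp
  qed
  show nz\<phi>: "deriv \<phi> z \<noteq> 0" using z(1) h nz by (simp add: d\<phi>)
  have dd\<phi>: "deriv (deriv \<phi>) z = l * deriv L z * exp (l * L z) * (deriv h z * (1 + l * \<omega> z))
      + exp (l * L z) * (deriv (deriv h) z * (1 + l * \<omega> z) + deriv h z * (l * deriv \<omega> z))"
  proof (rule DERIV_imp_deriv)
    have "((\<lambda>x. exp (l * L x) * (deriv h x * (1 + l * \<omega> x))) has_field_derivative
       l * deriv L z * exp (l * L z) * (deriv h z * (1 + l * \<omega> z))
      + exp (l * L z) * (deriv (deriv h) z * (1 + l * \<omega> z) + deriv h z * (l * deriv \<omega> z))) (at z)"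
      using z(1) by (auto intro!: derivative_eq_intros dh' dL d\<omega> simp: algebra_simps)
    then show "(deriv \<phi> has_field_derivative
       l * deriv L z * exp (l * L z) * (deriv h z * (1 + l * \<omega> z))
      + exp (l * L z) * (deriv (deriv h) z * (1 + l * \<omega> z) + deriv h z * (l * deriv \<omega> z))) (at z)"
      by (rule has_field_derivative_transform_within_open[OF _ S z(1)]) (simp add: d\<phi>)
  qed
  define R where "R = deriv h z / h z"
  define T where "T = l / (1 + l * \<omega> z) + cnj (\<omega> z) / of_real (1 - (cmod (\<omega> z))\<^sup>2)"
  have "deriv L z = \<omega> z * R" using z(1) h by (simp add: \<omega>_eq R_def)
  have "deriv (deriv \<phi>) z / deriv \<phi> z
      = l * deriv L z + deriv (deriv h) z / deriv h z + l * deriv \<omega> z / (1 + l * \<omega> z)"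
  proof -
    have "(p * E * (H * X) + E * (H2 * X + H * q)) / (E * (H * X)) = p + H2 / H + q / X"
      if "E \<noteq> 0" "H \<noteq> 0" "X \<noteq> 0" for p q E H H2 X :: complex
      using that by (simp add: field_simps)
    then show ?thesis
      unfolding dd\<phi> d\<phi>[OF z(1)] using h(3)[OF z(1)] nz[OF z(1)] exp_not_eq_zero by blast
  qed
  also have "\<dots> = pre_schwarzian h g z + (l - 1) * \<omega> z * R + deriv \<omega> z * T"
    by (simp add: pre_schwarzian_def \<open>deriv L z = _\<close> T_def R_def \<omega>_def algebra_simps)
  finally have ratio: "deriv (deriv \<phi>) z / deriv \<phi> z = \<dots>" .
  define s where "s = 1 - (cmod z)\<^sup>2"
  have s: "s \<ge> 0" using z(2) by (simp add: s_def power_le_one)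
  have "of_real s * (z * deriv (deriv \<phi>) z / deriv \<phi> z) + c * of_real ((cmod z)\<^sup>2)
      = (of_real s * z * pre_schwarzian h g z + c * of_real ((cmod z)\<^sup>2))
        + (l - 1) * \<omega> z * (of_real s * z * R) + of_real s * (z * deriv \<omega> z) * T"
    unfolding times_divide_eq_right[symmetric] ratio by (simp add: algebra_simps)
  also have "cmod \<dots> \<le> cmod (of_real s * z * pre_schwarzian h g z + c * of_real ((cmod z)\<^sup>2))
        + cmod ((l - 1) * \<omega> z * (of_real s * z * R)) + cmod (of_real s * (z * deriv \<omega> z) * T)"
    by (rule norm_triangle_le[OF add_right_mono[OF norm_triangle_ineq]])
  \<comment> \<open>Here \<open>cmod (l - 1) \<le> 2\<close> and
    \<open>cmod (\<omega> z) < 1\<close> combine to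
    \<open>2 * cmod (\<omega> z) \<le> 1 + cmod (\<omega> z)\<close>, the coefficient in the
    criterion.\<close>
  also have "cmod ((l - 1) * \<omega> z * (of_real s * z * R)) \<le> (1 + cmod (\<omega> z)) * cmod (of_real s * z * R)"
  proof -
    have "cmod (l - 1) \<le> 2" using norm_triangle_ineq4[of l 1] l by simp
    then have "cmod ((l - 1) * \<omega> z) \<le> 2 * cmod (\<omega> z)"
      by (simp add: norm_mult mult_right_mono)
    also have "\<dots> \<le> 1 + cmod (\<omega> z)" using \<omega>[OF z(1)] by (simp add: \<omega>_def)
    finally show ?thesis unfolding norm_mult[of "(l - 1) * \<omega> z"] by (rule mult_right_mono) simp
  qed
  also have "cmod (of_real s * (z * deriv \<omega> z) * T) = cmod (z * deriv \<omega> z) * s / (1 - (cmod (\<omega> z))\<^sup>2)"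
  proof -
    have "cmod T = 1 / (1 - (cmod (\<omega> z))\<^sup>2)"
      unfolding T_def using \<omega>[OF z(1)] by (intro norm_pre_schwarzian_term l) (simp add: \<omega>_def)
    then show ?thesis using s by (simp add: norm_mult)
  qed
  finally show "cmod (of_real (1 - (cmod z)\<^sup>2) * (z * deriv (deriv \<phi>) z / deriv \<phi> z) + c * of_real ((cmod z)\<^sup>2))
      \<le> criterion_lhs h g c z"
    by (simp add: criterion_lhs_def s_def R_def \<omega>_def)
qed

text \<open>The unimodular factor depends on the pair of points with equal image, hence the
  assumption for every \<open>l\<close> of modulus 1.\<close>

lemma logharmonic_injective:
  assumes "\<And>l. cmod l = 1 \<Longrightarrow> inj_on (\<lambda>z. h z * exp (l * L z)) S"
    and f: "\<And>z. z \<in> S \<Longrightarrow> f z = h z * cnj (exp (L z))"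
  shows "inj_on f S"
proof (rule inj_onI)
  fix x y assume xy: "x \<in> S" "y \<in> S" "f x = f y"
  define w where "w = L y - L x"
  \<comment> \<open>Multiplication by \<open>l\<close> turns \<open>w\<close> into its conjugate;
    for \<open>w = 0\<close> any unimodular number would do.\<close>
  define l where "l = (if w = 0 then 1 else cnj w / w)"
  have l: "cmod l = 1" "l * w = cnj w" by (auto simp: l_def norm_divide)
  have "h x * exp (cnj (L x)) = h y * exp (cnj (L y))"
    using xy f by (simp add: exp_cnj)
  also have "exp (cnj (L y)) = exp (l * w) * exp (cnj (L x))"
    unfolding l(2) by (simp add: w_def flip: exp_add)
  finally have "h x = h y * exp (l * w)" by simp
  then have "h x * exp (l * L x) = h y * exp (l * L y)"
    by (simp add: w_def mult.assoc right_diff_distrib flip: exp_add)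
  then show "x = y" using assms(1)[OF l(1)] xy by (auto dest: inj_onD)
qed

section \<open>Sharpness of the constant\<close>

text \<open>The sharpness example is \<open>h = exp (\<i> \<eta> strip_map)\<close>, \<open>g = 1\<close>, a covering of an annulus. The
  strip map satisfies Ahlfors' criterion for the excluded value \<open>c = -1\<close>; passing to \<open>h\<close> and to
  \<open>c = \<eta> - 1\<close> costs only \<open>O(\<eta>)\<close>.\<close>

lemma strip_criterion:
  assumes "cmod z < 1"
  shows "cmod (of_real (1 - (cmod z)\<^sup>2) * (2 * z\<^sup>2 / (1 - z\<^sup>2)) - of_real ((cmod z)\<^sup>2)) \<le> 1"
    and "(1 - (cmod z)\<^sup>2) * cmod (1 / (1 - z\<^sup>2)) \<le> 1"
proof -
  define y where "y = z\<^sup>2"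
  define x where "x = cmod y"
  have x_eq: "(cmod z)\<^sup>2 = x" by (simp add: x_def y_def norm_power)
  have x: "0 \<le> x" "x < 1" using assms by (auto simp flip: x_eq simp: power_less_one_iff)
  have R: "Re y \<le> x" and x2: "(Re y)\<^sup>2 + (Im y)\<^sup>2 = x\<^sup>2"
    by (auto simp: x_def complex_Re_le_cmod cmod_power2)
  have "1 - x \<le> cmod (1 - y)" using norm_triangle_ineq2[of 1 y] by (simp add: x_def)
  then show "(1 - (cmod z)\<^sup>2) * cmod (1 / (1 - z\<^sup>2)) \<le> 1"
    using x unfolding x_eq y_def[symmetric] by (simp add: norm_divide divide_le_eq)
  have nz: "1 - y \<noteq> 0" using \<open>1 - x \<le> _\<close> x by auto
  have "(cmod (2 * y - of_real x * (1 + y)))\<^sup>2 \<le> (cmod (1 - y))\<^sup>2"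
  proof -
    have "(cmod (1 - y))\<^sup>2 = 1 - 2 * Re y + x\<^sup>2"
      unfolding x2[symmetric] cmod_power2 by (simp add: power2_eq_square algebra_simps)
    moreover have "(cmod (2 * y - of_real x * (1 + y)))\<^sup>2
        = (2 - x)\<^sup>2 * ((Re y)\<^sup>2 + (Im y)\<^sup>2) - 2 * x * (2 - x) * Re y + x\<^sup>2"
      unfolding cmod_power2 by (simp add: power2_eq_square algebra_simps)
    \<comment> \<open>The difference of the squared moduli factors into terms that are nonnegative
      because \<open>Re y \<le> cmod y = x < 1\<close>.\<close>
    ultimately have "(cmod (1 - y))\<^sup>2 - (cmod (2 * y - of_real x * (1 + y)))\<^sup>2
        = (1 - x)\<^sup>2 * ((1 - x) * (1 + x) + 2 * (x - Re y))"
      unfolding x2 by (simp add: power2_eq_square algebra_simps)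
    also have "\<dots> \<ge> 0" using x R by (intro mult_nonneg_nonneg add_nonneg_nonneg) auto
    finally show ?thesis by simp
  qed
  then have "cmod (2 * y - of_real x * (1 + y)) \<le> cmod (1 - y)"
    by (rule power2_le_imp_le) simp
  moreover have "of_real (1 - x) * (2 * y / (1 - y)) - of_real x = (2 * y - of_real x * (1 + y)) / (1 - y)"
    using nz by (simp add: field_simps)
  ultimately show "cmod (of_real (1 - (cmod z)\<^sup>2) * (2 * z\<^sup>2 / (1 - z\<^sup>2)) - of_real ((cmod z)\<^sup>2)) \<le> 1"
    using nz unfolding x_eq y_def[symmetric] by (simp add: norm_divide divide_le_eq)
qed

text \<open>The conformal map \<open>log ((1 + z) / (1 - z))\<close> of the disc onto the strip of
  imaginary parts below \<open>pi / 2\<close> in absolute value. Both arguments of \<open>Ln\<close>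
  stay in the right half-plane, away from the branch cut.\<close>

definition strip_map :: "complex \<Rightarrow> complex" where
  "strip_map z = Ln (1 + z) - Ln (1 - z)"

lemma strip_map_has_field_derivative:
  assumes "cmod z < 1"
  shows "(strip_map has_field_derivative 2 / (1 - z\<^sup>2)) (at z)"
proof -
  have "\<bar>Re z\<bar> < 1" using assms abs_Re_le_cmod[of z] by linarith
  then have Re: "Re (1 + z) > 0" "Re (1 - z) > 0" by auto
  then have nz: "1 + z \<noteq> 0" "1 - z \<noteq> 0" by (metis less_irrefl zero_complex.simps(1))+
  have D: "((\<lambda>z. Ln (1 + z) - Ln (1 - z)) has_field_derivative 1 / (1 + z) + 1 / (1 - z)) (at z)"
    using Re nz by (auto intro!: derivative_eq_intros simp: complex_nonpos_Reals_iff field_simps)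
  have "1 / (1 + z) + 1 / (1 - z) = 2 / ((1 + z) * (1 - z))" using nz by (simp add: add_frac_eq)
  also have "(1 + z) * (1 - z) = 1 - z\<^sup>2" by (simp add: power2_eq_square algebra_simps)
  finally show ?thesis using D unfolding strip_map_def by simp
qed

lemma strip_map_attains_real: "\<exists>z. cmod z < 1 \<and> strip_map z = of_real s"
proof -
  \<comment> \<open>The solution of \<open>(1 + x) / (1 - x) = exp s\<close>, that is,
    \<open>tanh (s / 2)\<close>.\<close>
  define x where "x = (exp s - 1) / (exp s + 1)"
  have e: "exp s + 1 > 0" using exp_gt_zero[of s] by linarith
  have x: "1 + x = 2 * exp s / (exp s + 1)" "1 - x = 2 / (exp s + 1)"
    using e by (auto simp: x_def field_simps)
  then have pos: "1 + x > 0" "1 - x > 0" using e by auto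
  have "strip_map (of_real x) = of_real (ln (1 + x) - ln (1 - x))"
    using pos Ln_of_real[of "1 + x"] Ln_of_real[of "1 - x"] by (simp add: strip_map_def)
  also have "ln (1 + x) - ln (1 - x) = s"
    unfolding x using e by (simp add: ln_div ln_mult)
  finally show ?thesis using pos by (intro exI[of _ "of_real x"]) auto
qed

lemma criterion_constant_sharp:
  assumes "1 < C"
  obtains f h g c where "sense_preserving_logharmonic_on (ball 0 1) f h g" "cmod c \<le> 1" "c \<noteq> -1"
    "\<And>z. z \<in> ball 0 1 \<Longrightarrow> criterion_lhs h g c z \<le> C" "\<not> inj_on f (ball 0 1)"
proof -
  \<comment> \<open>The total loss is \<open>5 * \<eta>\<close>: in the first summand
    \<open>2 * \<eta>\<close> comes from the exponential and \<open>\<eta>\<close> from replacing -1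
    by \<open>c\<close>, and the second summand contributes \<open>2 * \<eta>\<close>. The bound
    \<open>\<eta> \<le> 1\<close> keeps \<open>c = \<eta> - 1\<close> in the closed unit
    disc.\<close>
  define \<eta> where "\<eta> = min 1 ((C - 1) / 5)"
  have "\<eta> \<le> (C - 1) / 5" unfolding \<eta>_def by (rule min.cobounded2)
  then have "5 * \<eta> \<le> C - 1" by simp
  moreover have "0 < \<eta>" "\<eta> \<le> 1" using assms by (auto simp: \<eta>_def)
  ultimately have \<eta>: "0 < \<eta>" "\<eta> \<le> 1" "5 * \<eta> \<le> C - 1" by auto
  define k where "k = \<i> * of_real \<eta>"
  have k: "k \<noteq> 0" "cmod k = \<eta>" using \<eta> by (auto simp: k_def norm_mult)
  define h where "h z = exp (k * strip_map z)" for z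
  define g where "g = (\<lambda>z :: complex. 1 :: complex)"
  define c where "c = complex_of_real (\<eta> - 1)"
  have nz: "1 - z\<^sup>2 \<noteq> 0" if "cmod z < 1" for z :: complex
  proof
    assume "1 - z\<^sup>2 = 0"
    then have "cmod (z\<^sup>2) = 1" by simp
    then have "(cmod z)\<^sup>2 = 1" by (simp add: norm_power)
    moreover have "(cmod z)\<^sup>2 < 1" using that by (simp add: power_less_one_iff)
    ultimately show False by simp
  qed
  have Dh: "(h has_field_derivative h z * (2 * k / (1 - z\<^sup>2))) (at z)" if "cmod z < 1" for z
    unfolding h_def using that
    by (auto intro!: derivative_eq_intros strip_map_has_field_derivative)
  then have dh: "deriv h z = h z * (2 * k / (1 - z\<^sup>2))" if "cmod z < 1" for z
    using that DERIV_imp_deriv by blast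
  have ddh: "deriv (deriv h) z = h z * (2 * k / (1 - z\<^sup>2)) * ((2 * k + 2 * z) / (1 - z\<^sup>2))"
    if z: "cmod z < 1" for z
  proof (rule DERIV_imp_deriv)
    have "((\<lambda>z. h z * (2 * k / (1 - z\<^sup>2))) has_field_derivative
        h z * (2 * k / (1 - z\<^sup>2)) * ((2 * k + 2 * z) / (1 - z\<^sup>2))) (at z)"
      using nz[OF z] by (auto intro!: derivative_eq_intros Dh[OF z] simp: divide_simps) (simp add: algebra_simps power2_eq_square)
    then show "(deriv h has_field_derivative
        h z * (2 * k / (1 - z\<^sup>2)) * ((2 * k + 2 * z) / (1 - z\<^sup>2))) (at z)"
      by (rule has_field_derivative_transform_within_open[where S = "ball 0 1"]) (use z dh in auto)
  qed
  have \<omega>: "lh_dilatation h g = (\<lambda>z. 0)" by (simp add: lh_dilatation_def g_def fun_eq_iff)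
  have hol: "h holomorphic_on ball 0 1"
    unfolding holomorphic_on_open[OF open_ball] using Dh by (metis mem_ball_0)
  have "sense_preserving_logharmonic_on (ball 0 1) h h g"
    unfolding sense_preserving_logharmonic_on_def \<omega> using hol nz k
    by (auto simp: g_def h_def dh)
  moreover have "cmod c \<le> 1" "c \<noteq> -1"
    using \<eta> by (auto simp: c_def simp del: of_real_diff) (auto simp: complex_eq_iff)
  moreover have "criterion_lhs h g c z \<le> C" if "z \<in> ball 0 1" for z
  proof -
    have z: "cmod z < 1" using that by simp
    define s where "s = 1 - (cmod z)\<^sup>2"
    have s: "0 \<le> s" using z by (simp add: s_def power_le_one)
    have P: "pre_schwarzian h g z = (2 * k + 2 * z) / (1 - z\<^sup>2)"
      using nz[OF z] k by (simp add: pre_schwarzian_def \<omega> dh[OF z] ddh[OF z] h_def)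
    define B where "B = of_real s * z * (2 * k / (1 - z\<^sup>2))"
    have B: "cmod B \<le> 2 * \<eta>"
    proof -
      have "cmod B = 2 * \<eta> * (cmod z * (s * cmod (1 / (1 - z\<^sup>2))))"
        using s k(2) by (simp add: B_def norm_mult norm_divide)
      also have "\<dots> \<le> 2 * \<eta> * (1 * 1)"
        using strip_criterion(2)[OF z] z s \<eta> by (intro mult_left_mono mult_mono) (auto simp: s_def)
      finally show ?thesis by simp
    qed
    \<comment> \<open>The bracket is the expression for the strip map with -1 in place of
      \<open>c\<close>; the other two terms are the perturbations of order
      \<open>\<eta>\<close>.\<close>
    have "of_real s * z * pre_schwarzian h g z + c * of_real ((cmod z)\<^sup>2)
        = (of_real s * (2 * z\<^sup>2 / (1 - z\<^sup>2)) - of_real ((cmod z)\<^sup>2)) + B + of_real (\<eta> * (cmod z)\<^sup>2)"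
      by (simp add: P B_def c_def add_divide_distrib power2_eq_square algebra_simps)
    also have "cmod \<dots> \<le> cmod (of_real s * (2 * z\<^sup>2 / (1 - z\<^sup>2)) - of_real ((cmod z)\<^sup>2))
        + cmod B + cmod (of_real (\<eta> * (cmod z)\<^sup>2))"
      by (rule norm_triangle_le[OF add_right_mono[OF norm_triangle_ineq]])
    also have "\<dots> \<le> 1 + 2 * \<eta> + \<eta> * 1"
    proof (intro add_mono)
      show "cmod (of_real s * (2 * z\<^sup>2 / (1 - z\<^sup>2)) - of_real ((cmod z)\<^sup>2)) \<le> 1"
        unfolding s_def by (rule strip_criterion(1)[OF z])
      show "cmod (of_real (\<eta> * (cmod z)\<^sup>2) :: complex) \<le> \<eta> * 1"
        using \<eta> z unfolding norm_of_real by (simp add: abs_mult power_le_one)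
    qed (rule B)
    finally have "cmod (of_real s * z * pre_schwarzian h g z + c * of_real ((cmod z)\<^sup>2)) \<le> 1 + 3 * \<eta>"
      by simp
    moreover have "of_real s * z * (deriv h z / h z) = B"
      using z by (simp add: dh B_def h_def)
    ultimately have "criterion_lhs h g c z \<le> 1 + 3 * \<eta> + 2 * \<eta>"
      using B by (simp add: criterion_lhs_def \<omega> s_def)
    then show ?thesis using \<eta>(3) by simp
  qed
  moreover have "\<not> inj_on h (ball 0 1)"
  proof
    assume inj: "inj_on h (ball 0 1)"
    \<comment> \<open>A translation of the strip by \<open>2 * pi / \<eta>\<close> is one period of
      \<open>exp (\<i> * \<eta> * s)\<close>, so this point and 0 have the same image.\<close>
    obtain z where z: "cmod z < 1" "strip_map z = of_real (2 * pi / \<eta>)"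
      using strip_map_attains_real by blast
    have "h z = exp (2 * of_real pi * \<i>)" using \<eta> by (simp add: h_def z(2) k_def mult_ac)
    also have "\<dots> = h 0" by (simp add: h_def strip_map_def)
    finally have "z = 0" using inj z(1) by (auto dest: inj_onD)
    then show False using z(2) \<eta> by (simp add: strip_map_def)
  qed
  ultimately show ?thesis using that by blast
qed

theorem theorem4:
  shows "(\<forall>f h g c.
            sense_preserving_logharmonic_on (ball 0 1) f h g \<and> cmod c \<le> 1 \<and> c \<noteq> -1 \<and>
            (\<forall>z\<in>ball 0 1. criterion_lhs h g c z \<le> 1)
            \<longrightarrow> inj_on f (ball 0 1)) \<and>
         (\<forall>C>1. \<not> (\<forall>f h g c.
            sense_preserving_logharmonic_on (ball 0 1) f h g \<and> cmod c \<le> 1 \<and> c \<noteq> -1 \<and>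
            (\<forall>z\<in>ball 0 1. criterion_lhs h g c z \<le> C)
            \<longrightarrow> inj_on f (ball 0 1)))"
proof (intro conjI allI impI)
  fix f h g c
  assume A: "sense_preserving_logharmonic_on (ball 0 1) f h g \<and> cmod c \<le> 1 \<and> c \<noteq> -1 \<and>
    (\<forall>z\<in>ball 0 1. criterion_lhs h g c z \<le> 1)"
  then have h: "h holomorphic_on ball 0 1" "\<And>z. z \<in> ball 0 1 \<Longrightarrow> h z \<noteq> 0"
      "\<And>z. z \<in> ball 0 1 \<Longrightarrow> deriv h z \<noteq> 0"
    and g: "g holomorphic_on ball 0 1" "\<And>z. z \<in> ball 0 1 \<Longrightarrow> g z \<noteq> 0"
    and f: "\<And>z. z \<in> ball 0 1 \<Longrightarrow> f z = h z * cnj (g z)"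
    and \<omega>: "\<And>z. z \<in> ball 0 1 \<Longrightarrow> cmod (lh_dilatation h g z) < 1"
    by (auto simp: sense_preserving_logharmonic_on_def)
  \<comment> \<open>A global logarithm of \<open>g\<close> on the disc gives meaning to the complex
    powers \<open>exp (l * L z)\<close> of \<open>g\<close>.\<close>
  obtain L where L: "L holomorphic_on ball 0 1" "\<And>z. z \<in> ball 0 1 \<Longrightarrow> g z = exp (L z)"
    using contractible_imp_holomorphic_log[OF g(1) convex_imp_contractible[OF convex_ball] g(2)] by blast
  show "inj_on f (ball 0 1)"
  proof (rule logharmonic_injective)
    show "f z = h z * cnj (exp (L z))" if "z \<in> ball 0 1" for z
      using f[OF that] L(2)[OF that] by simp
    fix l :: complex assume l: "cmod l = 1"
    note le = ahlfors_le_logharmonic_criterion[OF h L \<omega> open_ball _ _ l]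
    have "ahlfors_criterion (\<lambda>z. h z * exp (l * L z)) c"
    proof
      show "(\<lambda>z. h z * exp (l * L z)) holomorphic_on ball 0 1"
        using h L by (intro holomorphic_intros)
      fix z :: complex assume z: "z \<in> ball 0 1"
      then have z': "cmod z < 1" by simp
      show "deriv (\<lambda>z. h z * exp (l * L z)) z \<noteq> 0" using le(1)[OF _ _ _ _ z z'] by simp
      show "cmod (of_real (1 - (cmod z)\<^sup>2) * (z * deriv (deriv (\<lambda>z. h z * exp (l * L z))) z
          / deriv (\<lambda>z. h z * exp (l * L z)) z) + c * of_real ((cmod z)\<^sup>2)) \<le> 1"
        by (rule order_trans[OF le(2)[OF _ _ _ _ z z']]) (use A z in auto)
    qed (use A in auto)
    then show "inj_on (\<lambda>z. h z * exp (l * L z)) (ball 0 1)"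
      by (rule ahlfors_criterion.univalent)
  qed
next
  fix C :: real assume "1 < C"
  then show "\<not> (\<forall>f h g c.
      sense_preserving_logharmonic_on (ball 0 1) f h g \<and> cmod c \<le> 1 \<and> c \<noteq> -1 \<and>
      (\<forall>z\<in>ball 0 1. criterion_lhs h g c z \<le> C)
      \<longrightarrow> inj_on f (ball 0 1))"
    using criterion_constant_sharp[of C] by metis
qed

end
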